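(* Let $m,N$ be positive integers and $\alpha>0$. For $N\ge\max(\alpha m^2,m+1)$, we have $$\frac{N!/(N-m)!}{N^m}\ge\exp(-4^{-1})\exp(-1/\alpha).$$ In particular, by setting $\alpha=8$ we obtain $$\frac{N!/(N-m)!}{N^m}\ge\exp(-1/4)\ge 3/4,$$ thus achieving a bound $\|\mathrm{I}-S\|_1\le 1/2$, independently of $m$. Conversely, if $N$ as a function of $m$ is such that $N/m^2\to0$, we have $\|\mathrm{I}-S\|_1\to1$, ruling out uniform linear convergence of the iterated bootstrap.
   Context: $\Pi(m)$ is the set of partitions of $\{1,\dots,m\}$, partially ordered by $\pi\le\sigma$ iff $\pi$ is a refinement of $\sigma$; $\#\pi$ is the number of parts. $S\in\mathbb{R}^{\Pi(m)\times\Pi(m)}$ is the matrix with $$S_{\pi,\sigma}=\frac{N!/(N-\#\pi)!}{N^{\#\sigma}}\ \text{ if }\sigma\le\pi,\qquad S_{\pi,\sigma}=0\text{ otherwise},$$ where $N!/(N-j)!$ counts the $j$-tuples of pairwise distinct elements of $\{1,\dots,N\}$ (so it is $0$ if $N<j$). This matrix represents the $N$-sample resampling operator $F\mapsto\mathbb{E}_{Y\sim_N X}[F(Y)]$ (where $Y$ is the empirical distribution of $N$ independent samples from $X$) on coefficient vectors $f$ of moment polynomials $F(X)=\sum_{\pi\in\Pi(m)}f_\pi\prod_{p\in\pi}\mathbb{E}_{x\sim X}[\prod_{i\in p}x_i]$. The $k$-times iterated bootstrap for $F$ corresponds to $k$ steps of Richardson iteration $f^{(k+1)}=f^{(k)}+(f-Sf^{(k)})$,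 $f^{(0)}=f$, and its bias has coefficient vector $Sf^{(k)}-f$, which is multiplied by $\mathrm{I}-S$ in each iteration. Uniform linear convergence means linear convergence of this bias in $k$ at a rate independent of $m$. $\mathrm{I}$ is the identity matrix and $\|\cdot\|_1$ is the operator norm induced by the $\ell^1$ norm.
   Formalization: In the converse the limit of ‖I−S‖₁ is 2, not 1: the columns of S are nonnegative and sum to 1, so ‖I−S‖₁ = 2(1 − N!/(N−m)!/N^m); for instance N = 1 gives norm 2 for every m ≥ 2. *)

theory Defs
  imports Complex_Main "HOL-Library.Disjoint_Sets"
begin

definition Parts :: "nat \<Rightarrow> nat set set set" where
  "Parts m = {\<pi>. partition_on {1..m} \<pi>}"

(* N!/(N-j)! with the convention that it vanishes for N < j; the case split is needed
   because N - j truncates to 0 on nat. *)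
definition fallfact :: "nat \<Rightarrow> nat \<Rightarrow> real" where
  "fallfact N j = (if j \<le> N then fact N / fact (N - j) else 0)"

(* Matrices and vectors indexed by a finite set I are functions, of which only the values
   on I matter: I = Parts m varies with m, so it cannot be an index type. *)
definition mat_vec :: "'i set \<Rightarrow> ('i \<Rightarrow> 'i \<Rightarrow> real) \<Rightarrow> ('i \<Rightarrow> real) \<Rightarrow> 'i \<Rightarrow> real" where
  "mat_vec I A v = (\<lambda>i. \<Sum>j\<in>I. A i j * v j)"

definition l1_norm :: "'i set \<Rightarrow> ('i \<Rightarrow> real) \<Rightarrow> real" where
  "l1_norm I v = (\<Sum>i\<in>I. \<bar>v i\<bar>)"

(* Same shape as the library's onorm; vectors vanishing on I contribute 0 / 0 = 0. *)
definition l1_opnorm :: "'i set \<Rightarrow> ('i \<Rightarrow> 'i \<Rightarrow> real) \<Rightarrow> real" where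
  "l1_opnorm I A = (SUP v. l1_norm I (mat_vec I A v) / l1_norm I v)"

definition id_matrix :: "'i \<Rightarrow> 'i \<Rightarrow> real" where
  "id_matrix i j = (if i = j then 1 else 0)"

(* refines {1..m} \<sigma> \<pi> says that \<sigma> is finer than or equal to \<pi>, i.e. \<sigma> \<le> \<pi>. *)
definition S :: "nat \<Rightarrow> nat \<Rightarrow> nat set set \<Rightarrow> nat set set \<Rightarrow> real" where
  "S m N \<pi> \<sigma> = (if refines {1..m} \<sigma> \<pi> then fallfact N (card \<pi>) / real N ^ card \<sigma> else 0)"

definition I_minus_S :: "nat \<Rightarrow> nat \<Rightarrow> nat set set \<Rightarrow> nat set set \<Rightarrow> real" where
  "I_minus_S m N \<pi> \<sigma> = id_matrix \<pi> \<sigma> - S m N \<pi> \<sigma>"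

primrec richardson :: "nat \<Rightarrow> nat \<Rightarrow> (nat set set \<Rightarrow> real) \<Rightarrow> nat \<Rightarrow> nat set set \<Rightarrow> real" where
  "richardson m N f 0 = f"
| "richardson m N f (Suc k) =
     (\<lambda>\<pi>. richardson m N f k \<pi> + (f \<pi> - mat_vec (Parts m) (S m N) (richardson m N f k) \<pi>))"

definition bias :: "nat \<Rightarrow> nat \<Rightarrow> (nat set set \<Rightarrow> real) \<Rightarrow> nat \<Rightarrow> nat set set \<Rightarrow> real" where
  "bias m N f k = (\<lambda>\<pi>. mat_vec (Parts m) (S m N) (richardson m N f k) \<pi> - f \<pi>)"

(* Only the rate \<rho> has to be independent of m; the constant C may depend on m and f.
   This is the weakest form of the notion, so its negation is the strongest. *)
definition uniform_linear_convergence :: "(nat \<Rightarrow> nat) \<Rightarrow> bool" where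
  "uniform_linear_convergence N \<longleftrightarrow>
     (\<exists>\<rho>. 0 \<le> \<rho> \<and> \<rho> < 1 \<and>
       (\<forall>m\<ge>1. \<forall>f. \<exists>C. \<forall>k. l1_norm (Parts m) (bias m (N m) f k) \<le> C * \<rho> ^ k))"

end

(* Every column of S sums to 1: the coarsenings of sigma, weighted by the number of injective
   labellings of their blocks by {1..N}, are counted by all N^(#sigma) labellings of the blocks of
   sigma. Since S is nonnegative with diagonal entries r(#sigma), where r(j) = N!/(N-j)!/N^j, the
   columns of I - S have l1 norm 2 (1 - r(#sigma)); as r decreases, the operator norm is
   2 (1 - r(m)), attained at the finest partition. This tends to 2 when r(m) tends to 0, which is
   the case if N/m^2 does. The coordinate of the bias at the finest partition is multiplied by
   exactly 1 - r(m) in each iteration, and this factor then tends to 1. *)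

theory Submission
  imports Defs
begin

section \<open>The falling factorial ratio\<close>

text \<open>The probability that j independent uniform draws from N elements are pairwise distinct;
  it is the r(j) of the overview.\<close>

definition distinct_ratio :: "nat \<Rightarrow> nat \<Rightarrow> real" where
  "distinct_ratio N j = fallfact N j / real N ^ j"

lemma fallfact_0 [simp]: "fallfact N 0 = 1"
  by (simp add: fallfact_def)

lemma fallfact_Suc: "fallfact N (Suc j) = fallfact N j * (real N - real j)"
proof (cases "Suc j \<le> N")
  case True
  then have "N - j = Suc (N - Suc j)" by simp
  with True have "fact (N - j) = (real N - real j) * fact (N - Suc j)"
    by (simp add: of_nat_diff)
  with True show ?thesis
    by (simp add: fallfact_def)
next
  case False
  then show ?thesis
    \<comment> \<open>At j = N the factor N - j vanishes; for j > N both sides are 0 by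
      convention.\<close>
    by (cases "j = N") (auto simp: fallfact_def)
qed

lemma fallfact_nonneg [simp]: "fallfact N j \<ge> 0"
  by (simp add: fallfact_def)

text \<open>The shape in which \<open>card_inj_on_subset_funcset\<close> counts injections.
  Truncated subtraction is harmless: for j > N the factor at i = N is 0.\<close>

lemma fallfact_eq_prod: "fallfact N j = real (\<Prod>i = 0..<j. N - i)"
proof (induction j)
  case (Suc j)
  show ?case
  proof (cases "j \<le> N")
    case True
    with Suc show ?thesis by (simp add: fallfact_Suc of_nat_diff)
  next
    case False
    then show ?thesis by (auto simp: fallfact_def intro!: bexI[of _ N])
  qed
qed simp

lemma distinct_ratio_Suc:
  "N \<ge> 1 \<Longrightarrow> distinct_ratio N (Suc j) = distinct_ratio N j * (1 - real j / real N)"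
  by (simp add: distinct_ratio_def fallfact_Suc field_simps)

lemma distinct_ratio_nonneg [simp]: "distinct_ratio N j \<ge> 0"
  by (simp add: distinct_ratio_def)

lemma distinct_ratio_Suc_le:
  assumes "N \<ge> 1"
  shows "distinct_ratio N (Suc j) \<le> distinct_ratio N j"
proof -
  have "distinct_ratio N j * (1 - real j / real N) \<le> distinct_ratio N j * 1"
    by (intro mult_left_mono) auto
  with assms show ?thesis by (simp add: distinct_ratio_Suc)
qed

lemma distinct_ratio_antimono:
  "N \<ge> 1 \<Longrightarrow> j \<le> k \<Longrightarrow> distinct_ratio N k \<le> distinct_ratio N j"
  using lift_Suc_antimono_le[of "distinct_ratio N" j k] distinct_ratio_Suc_le by blast

lemma distinct_ratio_le_1: "N \<ge> 1 \<Longrightarrow> distinct_ratio N j \<le> 1"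
  using distinct_ratio_antimono[of N 0 j] by (simp add: distinct_ratio_def)

text \<open>As the ratio is at most 1, passing from j to j + 1 loses at most j / N, while the
  quadratic bound gives up (2j + 1) / (2N).\<close>

lemma distinct_ratio_ge_linear:
  assumes "N \<ge> 1"
  shows "distinct_ratio N j \<ge> 1 - real j ^ 2 / (2 * real N)"
proof (induction j)
  case (Suc j)
  have "distinct_ratio N j * (real j / real N) \<le> 1 * (real j / real N)"
    using distinct_ratio_le_1[OF assms] by (intro mult_right_mono) auto
  then have "distinct_ratio N (Suc j) \<ge> distinct_ratio N j - real j / real N"
    by (simp add: distinct_ratio_Suc[OF assms] algebra_simps)
  moreover have "real (Suc j) ^ 2 / (2 * real N) \<ge> real j ^ 2 / (2 * real N) + real j / real N"
    using assms by (simp add: field_simps power2_eq_square)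
  ultimately show ?case using Suc by linarith
qed (simp add: distinct_ratio_def)

text \<open>The exponent \<open>\<Phi>(m) = m + (N - m) ln ((N - m) / N)\<close> is the integral of
  \<open>- ln (1 - x / N)\<close> over \<open>[0, m]\<close>, which dominates the sum of \<open>- ln (1 - i / N)\<close> over \<open>i < m\<close>
  because that function increases.\<close>
lemma distinct_ratio_ge_exp_entropy:
  assumes "m < N"
  shows "distinct_ratio N m \<ge>
    exp (- (real m + (real N - real m) * ln ((real N - real m) / real N)))"
  using assms
proof (induction m)
  case 0
  then show ?case by (simp add: distinct_ratio_def)
next
  case (Suc m)
  define a where "a = real N - real m"
  have a: "a > 1" "real N > 0" using Suc.prems by (auto simp: a_def)
  \<comment> \<open>The step needs \<Phi>(m + 1) - \<Phi>(m) \<ge> - ln (a / N). The difference of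
    the two sides is 1 - (a - 1) (ln a - ln (a - 1)), nonnegative by ln x \<le> x - 1 at x = a / (a
    - 1).\<close>
  have "ln (a / (a - 1)) \<le> a / (a - 1) - 1"
    using a by (intro ln_le_minus_one) auto
  also have "\<dots> = 1 / (a - 1)" using a by (simp add: field_simps)
  finally have "(a - 1) * (ln a - ln (a - 1)) \<le> 1"
    using a by (simp add: ln_div field_simps)
  then have "- (real (Suc m) + (a - 1) * ln ((a - 1) / real N))
      \<le> - (real m + a * ln (a / real N)) + ln (a / real N)"
    using a by (simp add: ln_div algebra_simps)
  then have "exp (- (real (Suc m) + (a - 1) * ln ((a - 1) / real N)))
      \<le> exp (- (real m + a * ln (a / real N)) + ln (a / real N))"
    by simp
  also have "\<dots> = exp (- (real m + a * ln (a / real N))) * (a / real N)"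
    using a by (simp add: exp_add exp_diff exp_minus)
  also have "\<dots> \<le> distinct_ratio N m * (a / real N)"
    using Suc a by (intro mult_right_mono) (auto simp: a_def)
  also have "\<dots> = distinct_ratio N (Suc m)"
    using a by (simp add: distinct_ratio_Suc a_def diff_divide_distrib)
  finally show ?case by (simp add: a_def algebra_simps)
qed

text \<open>Inserting ln (a / N) \<le> a / N - 1 = - m / N with a = N - m into the entropy exponent
  bounds it by m - a m / N = m^2 / N.\<close>

lemma distinct_ratio_ge_exp:
  assumes "m < N"
  shows "distinct_ratio N m \<ge> exp (- (real m ^ 2 / real N))"
proof -
  define a where "a = real N - real m"
  have a: "a > 0" "real N > 0" "real m = real N - a" using assms by (auto simp: a_def)
  have "ln (a / real N) \<le> a / real N - 1"
    using a by (intro ln_le_minus_one) auto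
  then have "real m + a * ln (a / real N) \<le> real m + a * (a / real N - 1)"
    using a by (intro add_left_mono mult_left_mono) auto
  also have "\<dots> = real m ^ 2 / real N"
    unfolding a(3) using a(1,2) by (simp add: field_simps power2_eq_square)
  finally have "exp (- (real m ^ 2 / real N)) \<le> exp (- (real m + a * ln (a / real N)))"
    by simp
  also have "\<dots> \<le> distinct_ratio N m"
    using distinct_ratio_ge_exp_entropy[OF assms] by (simp add: a_def)
  finally show ?thesis .
qed

text \<open>Each factor satisfies 1 - i / N \<le> exp (- i / N), and the i / N with i < m add up to
  m (m - 1) / (2N).\<close>

lemma distinct_ratio_le_exp:
  assumes "N \<ge> 1"
  shows "distinct_ratio N m \<le> exp (- (real m * (real m - 1) / (2 * real N)))"
proof (induction m)
  case (Suc m)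
  have "distinct_ratio N m * (1 - real m / real N) \<le> distinct_ratio N m * exp (- (real m / real N))"
    using exp_ge_add_one_self[of "- (real m / real N)"] by (intro mult_left_mono) auto
  also have "\<dots> \<le> exp (- (real m * (real m - 1) / (2 * real N))) * exp (- (real m / real N))"
    using Suc by (intro mult_right_mono) auto
  also have "\<dots> = exp (- (real (Suc m) * (real (Suc m) - 1) / (2 * real N)))"
    using assms by (simp flip: exp_add add: field_simps)
  finally show ?case using assms by (simp add: distinct_ratio_Suc)
qed (simp add: distinct_ratio_def)

text \<open>For m \<ge> 2, m - 1 \<ge> m / 2, so the exponent is at least x = m^2 / (4N); then exp
  (- x) \<le> 1 / x. This makes the ratio tend to 0 along with N / m^2.\<close>

lemma distinct_ratio_le_quadratic:
  assumes "N \<ge> 1" "m \<ge> 2"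
  shows "distinct_ratio N m \<le> 4 * (real N / real m ^ 2)"
proof -
  define x where "x = real m ^ 2 / (4 * real N)"
  have x: "x > 0" using assms by (simp add: x_def)
  have "real m * 2 \<le> real m * real m" using assms by (intro mult_left_mono) auto
  then have "x \<le> real m * (real m - 1) / (2 * real N)"
    using assms by (simp add: x_def field_simps power2_eq_square)
  then have "distinct_ratio N m \<le> exp (- x)"
    using distinct_ratio_le_exp[OF assms(1), of m] by (smt (verit) exp_le_cancel_iff)
  also have "\<dots> = 1 / exp x" by (simp add: exp_minus field_simps)
  also have "\<dots> \<le> 1 / x"
    using x exp_ge_add_one_self[of x] by (intro divide_left_mono) (simp_all add: order.trans[of x "1 + x"])
  finally show ?thesis by (simp add: x_def)
qed

lemma distinct_ratio_tendsto_0: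
  assumes "\<And>m. m \<ge> 1 \<Longrightarrow> N m \<ge> 1" and "(\<lambda>m. real (N m) / real m ^ 2) \<longlonglongrightarrow> 0"
  shows "(\<lambda>m. distinct_ratio (N m) m) \<longlonglongrightarrow> 0"
proof (rule tendsto_sandwich[of "\<lambda>_. 0"])
  show "\<forall>\<^sub>F m in sequentially. distinct_ratio (N m) m \<le> 4 * (real (N m) / real m ^ 2)"
    using eventually_ge_at_top[of 2]
    by eventually_elim (use assms(1) distinct_ratio_le_quadratic in force)
  show "(\<lambda>m. 4 * (real (N m) / real m ^ 2)) \<longlonglongrightarrow> 0"
    using tendsto_mult[OF tendsto_const[of "4::real"] assms(2)] by simp
qed auto

section \<open>The operator norm as maximal column sum\<close>

lemma l1_norm_nonneg [simp]: "l1_norm I v \<ge> 0"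
  by (simp add: l1_norm_def sum_nonneg)

lemma l1_norm_mat_vec_le:
  assumes "\<And>j. j \<in> I \<Longrightarrow> (\<Sum>i\<in>I. \<bar>A i j\<bar>) \<le> K"
  shows "l1_norm I (mat_vec I A v) \<le> K * l1_norm I v"
proof -
  have "l1_norm I (mat_vec I A v) \<le> (\<Sum>i\<in>I. \<Sum>j\<in>I. \<bar>A i j\<bar> * \<bar>v j\<bar>)"
    unfolding l1_norm_def mat_vec_def
    by (intro sum_mono order.trans[OF sum_abs]) (simp add: abs_mult)
  also have "\<dots> = (\<Sum>j\<in>I. (\<Sum>i\<in>I. \<bar>A i j\<bar>) * \<bar>v j\<bar>)"
    by (subst sum.swap) (simp add: sum_distrib_right)
  also have "\<dots> \<le> (\<Sum>j\<in>I. K * \<bar>v j\<bar>)"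
    using assms by (intro sum_mono mult_right_mono) auto
  finally show ?thesis by (simp add: l1_norm_def sum_distrib_left)
qed

text \<open>No quotient exceeds the largest column sum, and the unit vector at a maximising column
  \<open>j\<close> attains it, so the supremum is a maximum.\<close>

lemma l1_opnorm_eqI:
  assumes "finite I" "j \<in> I" and max: "\<And>k. k \<in> I \<Longrightarrow> (\<Sum>i\<in>I. \<bar>A i k\<bar>) \<le> (\<Sum>i\<in>I. \<bar>A i j\<bar>)"
  shows "l1_opnorm I A = (\<Sum>i\<in>I. \<bar>A i j\<bar>)"
  unfolding l1_opnorm_def
proof (rule cSup_eq_maximum)
  define e where "e = (\<lambda>i. if i = j then 1 else 0 :: real)"
  have "l1_norm I e = 1" "l1_norm I (mat_vec I A e) = (\<Sum>i\<in>I. \<bar>A i j\<bar>)"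
    using assms(1,2) by (simp_all add: l1_norm_def mat_vec_def e_def if_distrib cong: if_cong)
  then show "(\<Sum>i\<in>I. \<bar>A i j\<bar>) \<in> range (\<lambda>v. l1_norm I (mat_vec I A v) / l1_norm I v)"
    by (intro image_eqI[of _ _ e]) auto
next
  fix x assume "x \<in> range (\<lambda>v. l1_norm I (mat_vec I A v) / l1_norm I v)"
  then obtain v where v: "x = l1_norm I (mat_vec I A v) / l1_norm I v" by auto
  show "x \<le> (\<Sum>i\<in>I. \<bar>A i j\<bar>)"
  proof (cases "l1_norm I v = 0")
    case False
    then have "l1_norm I v > 0" using l1_norm_nonneg[of I v] by linarith
    then show ?thesis
      using l1_norm_mat_vec_le[of I A, OF max] by (simp add: v divide_le_eq)
  qed (simp add: v sum_nonneg)
qed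

section \<open>Column sums of the resampling matrix\<close>

text \<open>A nonempty block cannot lie in two disjoint ones. This makes the map from fine blocks to
  their enclosing coarse blocks well defined.\<close>

lemma refines_block_unique:
  assumes "refines A \<sigma> \<pi>" "p \<in> \<sigma>"
  shows "\<exists>!q. q \<in> \<pi> \<and> p \<subseteq> q"
proof -
  have "p \<noteq> {}" using assms by (auto simp: refines_def partition_on_def)
  moreover obtain q where "q \<in> \<pi>" "p \<subseteq> q" using assms by (auto simp: refines_def)
  moreover have "disjoint \<pi>" using assms by (auto simp: refines_def partition_on_def)
  ultimately show ?thesis by (metis Int_greatest disjointD subset_empty)
qed

text \<open>Sending each fine block to the coarse block around it is surjective, since every coarse
  block is a nonempty union of fine ones.\<close>

lemma refines_card_le:
  assumes "finite \<sigma>" "refines A \<sigma> \<pi>"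
  shows "card \<pi> \<le> card \<sigma>"
proof -
  define b where "b p = (THE q. q \<in> \<pi> \<and> p \<subseteq> q)" for p
  have "\<pi> \<subseteq> b ` \<sigma>"
  proof
    fix q assume q: "q \<in> \<pi>"
    then have "q \<noteq> {}" "partition_on q {p \<in> \<sigma>. p \<subseteq> q}"
      using assms refines_obtains_subset by (auto simp: refines_def partition_on_def)
    then obtain p where p: "p \<in> \<sigma>" "p \<subseteq> q" by (auto simp: partition_on_def)
    then have "b p = q"
      unfolding b_def using q refines_block_unique[OF assms(2) p(1)] by (intro the1_equality) auto
    with p show "q \<in> b ` \<sigma>" by auto
  qed
  with assms(1) show ?thesis using surj_card_le by blast
qed

text \<open>A function on the blocks of \<open>\<sigma>\<close> is the same as a coarsening \<open>\<pi>\<close> of \<open>\<sigma>\<close> (its level sets)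
  together with an injective function on the blocks of \<open>\<pi>\<close>.\<close>
lemma sum_inj_coarsenings:
  fixes C :: "'c set"
  assumes "finite A" "partition_on A \<sigma>" "finite C"
  shows "(\<Sum>\<pi> | refines A \<sigma> \<pi>. card {g \<in> \<pi> \<rightarrow>\<^sub>E C. inj_on g \<pi>}) = card C ^ card \<sigma>"
proof -
  define b where "b \<pi> p = (THE q. q \<in> \<pi> \<and> p \<subseteq> q)" for \<pi> :: "'a set set" and p
  have b: "b \<pi> p \<in> \<pi>" "p \<subseteq> b \<pi> p" if "refines A \<sigma> \<pi>" "p \<in> \<sigma>" for \<pi> p
    using theI'[OF refines_block_unique[OF that]] by (auto simp: b_def)
  have b_eq: "b \<pi> p = q" if "refines A \<sigma> \<pi>" "p \<in> \<sigma>" "q \<in> \<pi>" "p \<subseteq> q" for \<pi> p q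
    using refines_block_unique[OF that(1,2)] that b by blast
  \<comment> \<open>\<open>F\<close> labels each block of \<open>\<sigma>\<close> by the label of
    the block of \<open>\<pi>\<close> around it. It will be a bijection from \<open>D\<close> onto
    all labellings of \<open>\<sigma>\<close>.\<close>
  define F where "F = (\<lambda>(\<pi>, g :: 'a set \<Rightarrow> 'c). \<lambda>p\<in>\<sigma>. g (b \<pi> p))"
  define D where "D = (SIGMA \<pi>:{\<pi>. refines A \<sigma> \<pi>}. {g \<in> \<pi> \<rightarrow>\<^sub>E C. inj_on g \<pi>})"
  \<comment> \<open>As \<open>g\<close> is injective, distinct blocks of \<open>\<pi>\<close> keep
    distinct labels, so \<open>F (\<pi>, g)\<close> determines them as unions of its level
    sets.\<close>
  have level: "q = \<Union>{p \<in> \<sigma>. F (\<pi>, g) p = g q}" if "(\<pi>, g) \<in> D" "q \<in> \<pi>" for \<pi> g q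
  proof -
    have r: "refines A \<sigma> \<pi>" and inj: "inj_on g \<pi>" using that by (auto simp: D_def)
    have "F (\<pi>, g) p = g q \<longleftrightarrow> p \<subseteq> q" if "p \<in> \<sigma>" for p
      using b[OF r that] b_eq[OF r that \<open>q \<in> \<pi>\<close>] inj \<open>q \<in> \<pi>\<close> that
      by (auto simp: F_def inj_on_def)
    then have "{p \<in> \<sigma>. F (\<pi>, g) p = g q} = {p \<in> \<sigma>. p \<subseteq> q}" by auto
    then show ?thesis
      using refines_obtains_subset[OF r \<open>q \<in> \<pi>\<close>] by (simp add: partition_on_def)
  qed
  \<comment> \<open>One inclusion of the injectivity claim; swapping the two pairs gives the
    other.\<close>
  have transfer: "q \<in> \<pi>' \<and> g q = g' q"
    if D: "(\<pi>, g) \<in> D" "(\<pi>', g') \<in> D" and eq: "F (\<pi>, g) = F (\<pi>', g')" and q: "q \<in> \<pi>" for \<pi> g \<pi>' g' q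
  proof -
    have r: "refines A \<sigma> \<pi>" "refines A \<sigma> \<pi>'" using D by (auto simp: D_def)
    have "q \<noteq> {}" using r q by (auto simp: refines_def partition_on_def)
    then obtain p where p: "p \<in> \<sigma>" "F (\<pi>, g) p = g q" using level[OF D(1) q] by blast
    define q' where "q' = b \<pi>' p"
    have q': "q' \<in> \<pi>'" using b(1)[OF r(2) p(1)] by (simp add: q'_def)
    have "F (\<pi>', g') p = g' q'" using p by (simp add: F_def q'_def)
    with p eq have gq: "g' q' = g q" by simp
    have "q' = q" using level[OF D(1) q] level[OF D(2) q'] gq eq by simp
    with q' gq show ?thesis by simp
  qed
  have "inj_on F D"
  proof (rule inj_onI, clarify)
    fix \<pi> g \<pi>' g' assume D: "(\<pi>, g) \<in> D" "(\<pi>', g') \<in> D" and eq: "F (\<pi>, g) = F (\<pi>', g')"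
    have "\<pi> = \<pi>'" using transfer[OF D eq] transfer[OF D(2,1) eq[symmetric]] by blast
    moreover have "g = g'"
    proof (rule PiE_ext)
      show "g \<in> \<pi> \<rightarrow>\<^sub>E C" "g' \<in> \<pi> \<rightarrow>\<^sub>E C" using D \<open>\<pi> = \<pi>'\<close> by (auto simp: D_def)
    qed (use transfer[OF D eq] in blast)
    ultimately show "\<pi> = \<pi>' \<and> g = g'" by simp
  qed
  moreover have "F ` D = \<sigma> \<rightarrow>\<^sub>E C"
  proof (intro equalityI subsetI)
    fix f assume "f \<in> F ` D"
    then obtain \<pi> g where D: "refines A \<sigma> \<pi>" "g \<in> \<pi> \<rightarrow>\<^sub>E C" and f: "f = F (\<pi>, g)"
      by (auto simp: D_def)
    then show "f \<in> \<sigma> \<rightarrow>\<^sub>E C" using b(1)[OF D(1)] by (auto simp: F_def)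
  next
    fix f assume f: "f \<in> \<sigma> \<rightarrow>\<^sub>E C"
    define B where "B c = \<Union>{p \<in> \<sigma>. f p = c}" for c
    have \<sigma>: "\<Union>\<sigma> = A" "{} \<notin> \<sigma>" and dis: "\<And>p q. p \<in> \<sigma> \<Longrightarrow> q \<in> \<sigma> \<Longrightarrow> p \<inter> q \<noteq> {} \<Longrightarrow> p = q"
      using assms(2) by (auto simp: partition_on_def disjoint_def)
    have B_ne: "B c \<noteq> {}" if "c \<in> f ` \<sigma>" for c using that \<sigma> by (force simp: B_def)
    have B_dis: "c = d" if "B c \<inter> B d \<noteq> {}" for c d using that dis by (force simp: B_def)
    have inj: "inj_on B (f ` \<sigma>)"
      using B_ne B_dis by (metis inj_onI inf.idem)
    define \<pi> where "\<pi> = B ` f ` \<sigma>"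
    define g where "g = restrict (inv_into (f ` \<sigma>) B) \<pi>"
    have part: "partition_on A \<pi>"
    proof (rule partition_onI)
      show "\<Union>\<pi> = A" using \<sigma> by (auto simp: \<pi>_def B_def)
      show "disjnt p q" if "p \<in> \<pi>" "q \<in> \<pi>" "p \<noteq> q" for p q
        using that B_dis unfolding \<pi>_def disjnt_def by (metis imageE)
      show "{} \<notin> \<pi>" using B_ne by (auto simp: \<pi>_def)
    qed
    have sub: "p \<subseteq> B (f p)" "B (f p) \<in> \<pi>" if "p \<in> \<sigma>" for p using that by (auto simp: B_def \<pi>_def)
    have r: "refines A \<sigma> \<pi>"
      unfolding refines_def using part assms(2) sub by blast
    have gB: "g (B c) = c" if "c \<in> f ` \<sigma>" for c
      using that inj by (simp add: g_def \<pi>_def)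
    have "g \<in> \<pi> \<rightarrow>\<^sub>E C"
    proof (rule PiE_I)
      show "g q \<in> C" if "q \<in> \<pi>" for q using that f gB by (auto simp: \<pi>_def)
    qed (simp add: g_def)
    moreover have "inj_on g \<pi>"
      unfolding \<pi>_def by (rule inj_on_inverseI[of _ B]) (use gB in auto)
    ultimately have "(\<pi>, g) \<in> D" using r by (simp add: D_def)
    moreover have "F (\<pi>, g) = f"
    proof
      show "F (\<pi>, g) p = f p" for p
        using f b_eq[OF r _ sub(2,1)] gB by (cases "p \<in> \<sigma>") (auto simp: F_def)
    qed
    ultimately show "f \<in> F ` D" by force
  qed
  ultimately have "card D = card (\<sigma> \<rightarrow>\<^sub>E C)" by (metis card_image)
  moreover have "card D = (\<Sum>\<pi> | refines A \<sigma> \<pi>. card {g \<in> \<pi> \<rightarrow>\<^sub>E C. inj_on g \<pi>})"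
    unfolding D_def
  proof (rule card_SigmaI)
    show "finite {\<pi>. refines A \<sigma> \<pi>}"
      by (rule finite_subset[OF _ finitely_many_partition_on[OF assms(1)]]) (auto simp: refines_def)
    show "\<forall>\<pi>\<in>{\<pi>. refines A \<sigma> \<pi>}. finite {g \<in> \<pi> \<rightarrow>\<^sub>E C. inj_on g \<pi>}"
      using assms finite_elements[OF assms(1)]
      by (auto simp: refines_def intro!: finite_PiE finite_Collect_conjI)
  qed
  moreover have "card (\<sigma> \<rightarrow>\<^sub>E C) = card C ^ card \<sigma>"
    using finite_elements[OF assms(1,2)] by (rule card_funcsetE)
  ultimately show ?thesis by simp
qed

text \<open>\<open>fallfact N (card \<pi>)\<close> counts the injective labellings of
  \<open>\<pi>\<close> by N labels, so this is the preceding count with C =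
  \<open>{..<N}\<close>.\<close>

lemma sum_fallfact_coarsenings:
  assumes "finite A" "partition_on A \<sigma>"
  shows "(\<Sum>\<pi> | refines A \<sigma> \<pi>. fallfact N (card \<pi>)) = real N ^ card \<sigma>"
proof -
  have "fallfact N (card \<pi>) = real (card {g \<in> \<pi> \<rightarrow>\<^sub>E {..<N}. inj_on g \<pi>})"
    if "refines A \<sigma> \<pi>" for \<pi>
  proof -
    have "finite \<pi>" using that assms(1) finite_elements by (auto simp: refines_def)
    then show ?thesis
      using card_inj_on_subset_funcset[where A = \<pi> and B = \<pi> and C = "{..<N}"] by (simp add: fallfact_eq_prod)
  qed
  then have "(\<Sum>\<pi> | refines A \<sigma> \<pi>. fallfact N (card \<pi>))
      = real (\<Sum>\<pi> | refines A \<sigma> \<pi>. card {g \<in> \<pi> \<rightarrow>\<^sub>E {..<N}. inj_on g \<pi>})"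
    by simp
  then show ?thesis
    using sum_inj_coarsenings[OF assms, of "{..<N}"] by simp
qed

section \<open>Columns of S and of I - S\<close>

lemma finite_Parts [simp]: "finite (Parts m)"
  by (simp add: Parts_def finitely_many_partition_on)

lemma S_nonneg: "S m N \<pi> \<sigma> \<ge> 0"
  by (simp add: S_def)

lemma S_diag: "\<sigma> \<in> Parts m \<Longrightarrow> S m N \<sigma> \<sigma> = distinct_ratio N (card \<sigma>)"
  by (simp add: S_def Parts_def refines_refl distinct_ratio_def)

lemma S_column_sum:
  assumes "\<sigma> \<in> Parts m" "N \<ge> 1"
  shows "(\<Sum>\<pi>\<in>Parts m. S m N \<pi> \<sigma>) = 1"
proof -
  have "{\<pi> \<in> Parts m. refines {1..m} \<sigma> \<pi>} = {\<pi>. refines {1..m} \<sigma> \<pi>}"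
    by (auto simp: Parts_def refines_def)
  then have "(\<Sum>\<pi>\<in>Parts m. S m N \<pi> \<sigma>)
      = (\<Sum>\<pi> | refines {1..m} \<sigma> \<pi>. fallfact N (card \<pi>) / real N ^ card \<sigma>)"
    by (simp add: S_def flip: sum.inter_filter)
  also have "\<dots> = 1"
    using assms sum_fallfact_coarsenings[of "{1..m}" \<sigma> N]
    by (simp add: Parts_def flip: sum_divide_distrib)
  finally show ?thesis .
qed

text \<open>The diagonal entry contributes 1 - r; the off-diagonal entries are those of - S and
  contribute the rest of the unit column mass, again 1 - r.\<close>

lemma I_minus_S_column_sum:
  assumes "\<sigma> \<in> Parts m" "N \<ge> 1"
  shows "(\<Sum>\<pi>\<in>Parts m. \<bar>I_minus_S m N \<pi> \<sigma>\<bar>) = 2 * (1 - distinct_ratio N (card \<sigma>))"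
proof -
  have "(\<Sum>\<pi>\<in>Parts m - {\<sigma>}. \<bar>I_minus_S m N \<pi> \<sigma>\<bar>) = (\<Sum>\<pi>\<in>Parts m - {\<sigma>}. S m N \<pi> \<sigma>)"
    by (intro sum.cong) (auto simp: I_minus_S_def id_matrix_def S_nonneg)
  moreover have "\<bar>I_minus_S m N \<sigma> \<sigma>\<bar> = 1 - distinct_ratio N (card \<sigma>)"
    using assms distinct_ratio_le_1[of N] by (simp add: I_minus_S_def id_matrix_def S_diag)
  ultimately show ?thesis
    using assms S_column_sum[OF assms] S_diag[OF assms(1), of N]
    by (simp add: sum.remove[of "Parts m" \<sigma>])
qed

section \<open>The finest partition and the operator norm\<close>

definition singletons :: "nat \<Rightarrow> nat set set" where
  "singletons m = (\<lambda>x. {x}) ` {1..m}"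

lemma singletons_in_Parts: "singletons m \<in> Parts m"
  by (simp add: singletons_def Parts_def partition_on_singletons)

lemma card_singletons: "card (singletons m) = m"
  by (simp add: singletons_def card_image)

lemma singletons_refines: "\<sigma> \<in> Parts m \<Longrightarrow> refines {1..m} (singletons m) \<sigma>"
  using singletons_in_Parts[of m] by (auto simp: refines_def Parts_def singletons_def partition_on_def)

lemma refines_singletons_iff:
  "\<sigma> \<in> Parts m \<Longrightarrow> refines {1..m} \<sigma> (singletons m) \<longleftrightarrow> \<sigma> = singletons m"
  using singletons_refines refines_asym by (blast intro: refines_refl)

lemma card_Parts_le: "\<sigma> \<in> Parts m \<Longrightarrow> card \<sigma> \<le> m"
  using refines_card_le[OF _ singletons_refines] card_singletons by (simp add: singletons_def)

lemma l1_opnorm_I_minus_S: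
  assumes "N \<ge> 1"
  shows "l1_opnorm (Parts m) (I_minus_S m N) = 2 * (1 - distinct_ratio N m)"
proof -
  note cs = I_minus_S_column_sum[OF _ assms]
  have "l1_opnorm (Parts m) (I_minus_S m N) = (\<Sum>\<pi>\<in>Parts m. \<bar>I_minus_S m N \<pi> (singletons m)\<bar>)"
    using singletons_in_Parts distinct_ratio_antimono[OF assms card_Parts_le]
    by (intro l1_opnorm_eqI) (simp_all add: cs card_singletons)
  then show ?thesis by (simp add: cs singletons_in_Parts card_singletons)
qed

section \<open>Slow decay of the bias\<close>

text \<open>Only the finest partition refines itself, so this coordinate evolves on its own.\<close>
lemma mat_vec_S_singletons:
  "mat_vec (Parts m) (S m N) v (singletons m) = distinct_ratio N m * v (singletons m)"
proof -
  have "mat_vec (Parts m) (S m N) v (singletons m)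
      = (\<Sum>\<sigma>\<in>Parts m. if \<sigma> = singletons m then distinct_ratio N m * v \<sigma> else 0)"
    unfolding mat_vec_def
  proof (intro sum.cong refl)
    fix \<sigma> assume "\<sigma> \<in> Parts m"
    then show "S m N (singletons m) \<sigma> * v \<sigma>
        = (if \<sigma> = singletons m then distinct_ratio N m * v \<sigma> else 0)"
      using S_diag[of \<sigma> m N] refines_singletons_iff[of \<sigma> m]
      by (auto simp add: card_singletons S_def simp del: One_nat_def times_divide_eq_left)
  qed
  then show ?thesis by (simp add: singletons_in_Parts)
qed

text \<open>The exponent is \<open>Suc k\<close> because the iteration starts at f, whose bias S f -
  f already carries one factor 1 - r.\<close>

lemma bias_singletons:
  "bias m N f k (singletons m) = - ((1 - distinct_ratio N m) ^ Suc k * f (singletons m))"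
proof (induction k)
  case (Suc k)
  have "bias m N f (Suc k) (singletons m) = (1 - distinct_ratio N m) * bias m N f k (singletons m)"
    by (simp add: bias_def mat_vec_S_singletons algebra_simps)
  with Suc show ?case by simp
qed (simp add: bias_def mat_vec_S_singletons algebra_simps)

lemma l1_norm_bias_ge:
  "l1_norm (Parts m) (bias m N f k) \<ge> \<bar>(1 - distinct_ratio N m) ^ Suc k * f (singletons m)\<bar>"
proof -
  have "\<bar>bias m N f k (singletons m)\<bar> \<le> l1_norm (Parts m) (bias m N f k)"
    unfolding l1_norm_def by (rule member_le_sum) (auto simp: singletons_in_Parts)
  then show ?thesis by (simp only: bias_singletons abs_minus_cancel)
qed

text \<open>Dividing by l^k would bound l > 0 by the null sequence C (\<rho> / l)^k, whatever C
  is.\<close>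

lemma not_geometric_domination:
  fixes l \<rho> :: real
  assumes "0 \<le> \<rho>" "\<rho> < l"
  shows "\<not> (\<forall>k. l ^ Suc k \<le> C * \<rho> ^ k)"
proof
  assume *: "\<forall>k. l ^ Suc k \<le> C * \<rho> ^ k"
  have l: "l > 0" using assms by simp
  have "(\<lambda>k. C * (\<rho> / l) ^ k) \<longlonglongrightarrow> C * 0"
    using assms l by (intro tendsto_mult tendsto_const LIMSEQ_realpow_zero) auto
  moreover have "l \<le> C * (\<rho> / l) ^ k" for k
    using *[rule_format, of k] l by (simp add: power_divide field_simps)
  ultimately have "l \<le> 0" by (intro LIMSEQ_le_const[of _ "0::real"]) auto
  with l show False by simp
qed

lemma not_uniform_linear_convergence:
  assumes "(\<lambda>m. distinct_ratio (N m) m) \<longlonglongrightarrow> 0"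
  shows "\<not> uniform_linear_convergence N"
proof
  assume "uniform_linear_convergence N"
  then obtain \<rho> where \<rho>: "0 \<le> \<rho>" "\<rho> < 1"
    and bd: "\<And>m f. m \<ge> 1 \<Longrightarrow> \<exists>C. \<forall>k. l1_norm (Parts m) (bias m (N m) f k) \<le> C * \<rho> ^ k"
    unfolding uniform_linear_convergence_def by blast
  \<comment> \<open>Since \<rho> is the same for all m, a single m with 1 - r(m) > \<rho> suffices.
    The constant vector 1 then serves as f, being nonzero at the finest partition.\<close>
  have "\<forall>\<^sub>F m in sequentially. distinct_ratio (N m) m < 1 - \<rho>"
    using order_tendstoD(2)[OF assms, of "1 - \<rho>"] \<rho> by simp
  then have "\<forall>\<^sub>F m in sequentially. distinct_ratio (N m) m < 1 - \<rho> \<and> m \<ge> 1"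
    using eventually_ge_at_top[of 1] by eventually_elim simp
  then obtain m where m: "distinct_ratio (N m) m < 1 - \<rho>" "m \<ge> 1"
    by (auto simp: eventually_sequentially)
  obtain C where "\<And>k. l1_norm (Parts m) (bias m (N m) (\<lambda>_. 1) k) \<le> C * \<rho> ^ k"
    using bd[OF m(2)] by blast
  then have "(1 - distinct_ratio (N m) m) ^ Suc k \<le> C * \<rho> ^ k" for k
    using l1_norm_bias_ge[where m = m and N = "N m" and f = "\<lambda>_. 1" and k = k] by (smt (verit) mult.right_neutral)
  with not_geometric_domination[of \<rho> "1 - distinct_ratio (N m) m" C] \<rho> m show False by auto
qed

theorem theorem5p4:
  shows
   "(\<forall>(m::nat) (N::nat) (\<alpha>::real).
       m \<ge> 1 \<and> N \<ge> 1 \<and> \<alpha> > 0 \<and> real N \<ge> max (\<alpha> * real m ^ 2) (real m + 1) \<longrightarrow>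
         (fact N / fact (N - m)) / real N ^ m \<ge> exp (- (1/4)) * exp (- (1/\<alpha>))) \<and>
    (\<forall>(m::nat) (N::nat).
       m \<ge> 1 \<and> N \<ge> 1 \<and> real N \<ge> max (8 * real m ^ 2) (real m + 1) \<longrightarrow>
         (fact N / fact (N - m)) / real N ^ m \<ge> exp (- (1/4)) \<and>
         exp (- (1/4)) \<ge> (3/4 :: real) \<and>
         l1_opnorm (Parts m) (I_minus_S m N) \<le> 1/2) \<and>
    (\<forall>N::nat \<Rightarrow> nat.
       (\<forall>m\<ge>1. N m \<ge> 1) \<and> (\<lambda>m. real (N m) / real m ^ 2) \<longlonglongrightarrow> 0 \<longrightarrow>
         (\<lambda>m. l1_opnorm (Parts m) (I_minus_S m (N m))) \<longlonglongrightarrow> 2 \<and>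
         \<not> uniform_linear_convergence N)"
proof (intro conjI allI impI; elim conjE)
  fix m N :: nat and \<alpha> :: real
  assume *: "m \<ge> 1" "N \<ge> 1" "\<alpha> > 0" "real N \<ge> max (\<alpha> * real m ^ 2) (real m + 1)"
  then have "real m ^ 2 / real N \<le> 1 / \<alpha>" by (simp add: field_simps)
  \<comment> \<open>As exp (- 1/4) \<le> 1, it suffices to reach exp (- 1/\<alpha>).\<close>
  have "exp (- (1/4)) * exp (- (1/\<alpha>)) \<le> 1 * exp (- (1/\<alpha>))"
    by (intro mult_right_mono) auto
  also have "\<dots> \<le> exp (- (real m ^ 2 / real N))"
    using \<open>real m ^ 2 / real N \<le> 1 / \<alpha>\<close> by simp
  also have "\<dots> \<le> distinct_ratio N m" using * by (intro distinct_ratio_ge_exp) auto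
  finally show "(fact N / fact (N - m)) / real N ^ m \<ge> exp (- (1/4)) * exp (- (1/\<alpha>))"
    using * by (simp add: distinct_ratio_def fallfact_def)
next
  show 34: "exp (- (1/4)) \<ge> (3/4 :: real)"
    using exp_ge_add_one_self[of "- (1/4) :: real"] by simp
  fix m N :: nat
  assume *: "m \<ge> 1" "N \<ge> 1" "real N \<ge> max (8 * real m ^ 2) (real m + 1)"
  \<comment> \<open>Putting \<alpha> = 8 into the first claim would give only exp (- 3/8). Instead
    exp (- 1/4) \<le> 4/5, whereas N \<ge> 8 m^2 makes the linear bound at least 15/16.\<close>
  have "exp (- (1/4)) = 1 / exp (1/4 :: real)" by (simp add: exp_minus field_simps)
  also have "\<dots> \<le> 1 / (1 + 1/4)"
    using exp_ge_add_one_self[of "1/4 :: real"] by (intro divide_left_mono) auto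
  also have "\<dots> \<le> 1 - real m ^ 2 / (2 * real N)"
    using * by (simp add: field_simps)
  also have "\<dots> \<le> distinct_ratio N m" by (rule distinct_ratio_ge_linear[OF *(2)])
  finally have r: "exp (- (1/4)) \<le> distinct_ratio N m" .
  then show "(fact N / fact (N - m)) / real N ^ m \<ge> exp (- (1/4))"
    using * by (simp add: distinct_ratio_def fallfact_def)
  \<comment> \<open>The norm is 2 (1 - r(m)) \<le> 2 (1 - 3/4).\<close>
  show "l1_opnorm (Parts m) (I_minus_S m N) \<le> 1/2"
    using r 34 * by (simp add: l1_opnorm_I_minus_S)
next
  fix N :: "nat \<Rightarrow> nat"
  assume N: "\<forall>m\<ge>1. N m \<ge> 1" and "(\<lambda>m. real (N m) / real m ^ 2) \<longlonglongrightarrow> 0"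
  then have lim: "(\<lambda>m. distinct_ratio (N m) m) \<longlonglongrightarrow> 0"
    by (intro distinct_ratio_tendsto_0) auto
  then show "\<not> uniform_linear_convergence N" by (rule not_uniform_linear_convergence)
  \<comment> \<open>The limit is 2 and not 1: in the finest column the diagonal entry and the
    off-diagonal mass each tend to 1 in absolute value. The limit 1 belongs to the contraction
    factor 1 - r(m) of the bias coordinate.\<close>
  have "(\<lambda>m. 2 * (1 - distinct_ratio (N m) m)) \<longlonglongrightarrow> 2 * (1 - 0)"
    by (intro tendsto_intros lim)
  moreover have "\<forall>\<^sub>F m in sequentially.
      2 * (1 - distinct_ratio (N m) m) = l1_opnorm (Parts m) (I_minus_S m (N m))"
    using eventually_ge_at_top[of 1]
    by eventually_elim (use N in \<open>simp add: l1_opnorm_I_minus_S\<close>)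
  ultimately show "(\<lambda>m. l1_opnorm (Parts m) (I_minus_S m (N m))) \<longlonglongrightarrow> 2"
    by (simp add: Lim_transform_eventually)
qed

end
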